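(* Let $\mathcal D\subseteq\mathcal S$ be a correction domain, $\mathcal U\subseteq\mathcal W$ a finite audit bank, $W\subseteq\mathcal U$ a deployment bank, and $\delta>0$, $\tau,\xi\ge0$. Let $\psi_W:\mathcal H\to\mathbb R^{W}$ estimate $\Phi_W(\pi(h))$ with uniform calibration error at most $\tau$ on $\pi^{-1}(\mathcal D)$, i.e. $\lVert\psi_W(h)-\Phi_W(\pi(h))\rVert_\infty\le\tau$ for all $h\in\pi^{-1}(\mathcal D)$. Suppose a corrector $Q:\mathcal H\to\mathcal H$ maps $\pi^{-1}(\mathcal D)$ into itself and obeys $\lVert\psi_W(Q(h))-\psi_W(h)\rVert_\infty\le\xi$ for all $h\in\pi^{-1}(\mathcal D)$. If $$\xi+2\tau<\Omega^{\mathcal D}_{W\mid\mathcal U}(\delta),$$ then for all $h\in\pi^{-1}(\mathcal D)$, $$d_{\mathcal U}(\pi(Q(h)),\pi(h))<\delta.$$ Moreover, if $\rho_{\mathcal U}$ is a completeness modulus for $\mathcal U$, then under the same condition the full-future distortion satisfies $d_\infty(\pi(Q(h)),\pi(h))<\rho_{\mathcal U}(\delta)$ for all $h\in\pi^{-1}(\mathcal D)$.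
   Context: $\mathcal H\subseteq\mathbb R^d$ is a hidden-state domain. $\mathcal W$ is a set of tests with expected outcomes $\phi_w(h)=\mathbb E[Y_w\mid h]\in[0,1]$, $w\in\mathcal W$, $h\in\mathcal H$. Hidden states $h,h'$ are equivalent iff $\phi_w(h)=\phi_w(h')$ for all $w\in\mathcal W$; $\mathcal S$ is the quotient and $\pi:\mathcal H\to\mathcal S$ the projection; $\phi_w$ descends to $\mathcal S$ and is written $\phi_w(s)$. For a set of tests $V\subseteq\mathcal W$, $\Phi_V(s)=(\phi_w(s))_{w\in V}$. Put $d_{\mathcal U}(s,s')=\lVert\Phi_{\mathcal U}(s)-\Phi_{\mathcal U}(s')\rVert_\infty$, $d_W(s,s')=\lVert\Phi_W(s)-\Phi_W(s')\rVert_\infty$, and $d_\infty(s,s')=\sup_{w\in\mathcal W}|\phi_w(s)-\phi_w(s')|$. The audited separation margin is $$\Omega^{\mathcal D}_{W\mid\mathcal U}(\delta)=\inf\{d_W(s,s'):\ s,s'\in\mathcal D,\ d_{\mathcal U}(s,s')\ge\delta\},$$ with the infimum over the empty set equal to $+\infty$. A completeness modulus for $\mathcal U$ is a function $\rho_{\mathcal U}$ satisfying $d_\infty(s,s')\le\rho_{\mathcal U}(d_{\mathcal U}(s,s'))$ for all $s,s'$ and $\rho_{\mathcal U}(r)\to0$ as $r\to0$.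
   Formalization: The "Moreover" claim fails as printed (one state, ρ=0 gives 0<0). Here d_∞<ρ(δ) is proved when ρ(r)<ρ(δ) for all 0≤r<δ, and d_∞≤ρ(δ) when only ρ(r)≤ρ(δ) for all 0≤r<δ (e.g. nondecreasing ρ). *)

theory Defs
  imports "HOL-Analysis.Analysis"
begin

text \<open>
  Throughout, \<open>H\<close> is the hidden-state domain, \<open>T\<close> the set of all tests, and
  \<open>\<phi> w h\<close> the expected outcome of test \<open>w\<close> in hidden state \<open>h\<close>, of which only its values
  for \<open>w \<in> T\<close>, \<open>h \<in> H\<close> matter.
\<close>

definition hidden_equiv :: "'h set \<Rightarrow> 'w set \<Rightarrow> ('w \<Rightarrow> 'h \<Rightarrow> real) \<Rightarrow> ('h \<times> 'h) set" where
  "hidden_equiv H T \<phi> = {(h, h'). h \<in> H \<and> h' \<in> H \<and> (\<forall>w\<in>T. \<phi> w h = \<phi> w h')}"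

definition state_space :: "'h set \<Rightarrow> 'w set \<Rightarrow> ('w \<Rightarrow> 'h \<Rightarrow> real) \<Rightarrow> 'h set set" where
  "state_space H T \<phi> = H // hidden_equiv H T \<phi>"

definition state_proj :: "'h set \<Rightarrow> 'w set \<Rightarrow> ('w \<Rightarrow> 'h \<Rightarrow> real) \<Rightarrow> 'h \<Rightarrow> 'h set" where
  "state_proj H T \<phi> h = hidden_equiv H T \<phi> `` {h}"

definition state_preimage ::
  "'h set \<Rightarrow> 'w set \<Rightarrow> ('w \<Rightarrow> 'h \<Rightarrow> real) \<Rightarrow> 'h set set \<Rightarrow> 'h set" where
  "state_preimage H T \<phi> D = {h \<in> H. state_proj H T \<phi> h \<in> D}"

text \<open>For \<open>w \<in> T\<close>, the function \<open>\<phi> w\<close> takes exactly one value on a class \<open>s\<close> of the quotient.\<close>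

definition state_outcome :: "('w \<Rightarrow> 'h \<Rightarrow> real) \<Rightarrow> 'w \<Rightarrow> 'h set \<Rightarrow> real" where
  "state_outcome \<phi> w s = the_elem (\<phi> w ` s)"

lemma state_outcome_state_proj:
  assumes "h \<in> H" "w \<in> T"
  shows "state_outcome \<phi> w (state_proj H T \<phi> h) = \<phi> w h"
proof -
  have "\<phi> w ` state_proj H T \<phi> h = {\<phi> w h}"
    using assms by (auto simp: state_proj_def hidden_equiv_def)
  then show ?thesis
    by (simp add: state_outcome_def)
qed

definition outcome_vector :: "('w \<Rightarrow> 'h \<Rightarrow> real) \<Rightarrow> 'w set \<Rightarrow> 'h set \<Rightarrow> 'w \<Rightarrow> real" where
  "outcome_vector \<phi> V s = (\<lambda>w\<in>V. state_outcome \<phi> w s)"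

text \<open>
  The sup-norm distance of two vectors indexed by \<open>V\<close>. Inserting \<open>0\<close> changes the supremum only for
  \<open>V = {}\<close>, where it gives the norm \<open>0\<close> of the zero-dimensional space.
\<close>

definition sup_dist :: "'w set \<Rightarrow> ('w \<Rightarrow> real) \<Rightarrow> ('w \<Rightarrow> real) \<Rightarrow> real" where
  "sup_dist V x y = Sup (insert 0 ((\<lambda>w. \<bar>x w - y w\<bar>) ` V))"

text \<open>The distance \<open>d\<^sub>\<infinity>\<close> is the case \<open>V = T\<close>.\<close>

definition bank_dist :: "('w \<Rightarrow> 'h \<Rightarrow> real) \<Rightarrow> 'w set \<Rightarrow> 'h set \<Rightarrow> 'h set \<Rightarrow> real" where
  "bank_dist \<phi> V s s' = sup_dist V (outcome_vector \<phi> V s) (outcome_vector \<phi> V s')"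

text \<open>Taken in \<^typ>\<open>ereal\<close>, the infimum over the empty set is \<open>\<infinity>\<close>.\<close>

definition separation_margin ::
  "('w \<Rightarrow> 'h \<Rightarrow> real) \<Rightarrow> 'h set set \<Rightarrow> 'w set \<Rightarrow> 'w set \<Rightarrow> real \<Rightarrow> ereal" where
  "separation_margin \<phi> D W U \<delta> =
     Inf {ereal (bank_dist \<phi> W s s') | s s'. s \<in> D \<and> s' \<in> D \<and> bank_dist \<phi> U s s' \<ge> \<delta>}"

text \<open>Only the values of \<open>\<rho>\<close> on \<open>[0, \<infinity>)\<close> matter, so the limit at \<open>0\<close> is one-sided.
  Monotonicity is not part of the notion.\<close>

definition completeness_modulus ::
  "'h set \<Rightarrow> 'w set \<Rightarrow> ('w \<Rightarrow> 'h \<Rightarrow> real) \<Rightarrow> 'w set \<Rightarrow> (real \<Rightarrow> real) \<Rightarrow> bool" where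
  "completeness_modulus H T \<phi> U \<rho> \<longleftrightarrow>
     (\<forall>s\<in>state_space H T \<phi>. \<forall>s'\<in>state_space H T \<phi>.
        bank_dist \<phi> T s s' \<le> \<rho> (bank_dist \<phi> U s s')) \<and>
     (\<rho> \<longlongrightarrow> 0) (at_right 0)"

end

theory Submission
  imports Defs
begin

text \<open>Compare the deployment vectors of \<open>Q h\<close> and \<open>h\<close> through their
  estimates: the path \<Phi>_W(\<pi>(Q h)), \<open>\<psi> (Q h)\<close>, \<open>\<psi> h\<close>,
  \<Phi>_W(\<pi>(h)) has steps of length at most \<tau>, \<xi>, \<tau>, so
  \<open>sup_dist_triangle\<close> bounds the \<open>W\<close>-distance of the two states by \<xi> +
  2\<tau>. Both states lie in \<open>D\<close>, and a pair in \<open>D\<close> that is closer than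
  the margin on \<open>W\<close> cannot be \<delta>-separated on \<open>U\<close>
  (\<open>bank_dist_lt_if_separation_margin\<close>). A completeness modulus turns the resulting
  audit distance r < \<delta> into the bound \<open>\<rho> r\<close> on the distance over all
  tests.\<close>

lemma sup_dist_le_iff:
  assumes "finite V"
  shows "sup_dist V x y \<le> c \<longleftrightarrow> 0 \<le> c \<and> (\<forall>w\<in>V. \<bar>x w - y w\<bar> \<le> c)"
  \<comment> \<open>The inserted 0 makes the set nonempty and yields the conjunct
    \<open>0 \<le> c\<close>; finiteness makes it bounded above.\<close>
  unfolding sup_dist_def using assms by (subst cSup_le_iff) auto

lemma sup_dist_nonneg: "finite V \<Longrightarrow> 0 \<le> sup_dist V x y"
  using sup_dist_le_iff[of V x y "sup_dist V x y"] by simp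

lemma sup_dist_commute: "sup_dist V x y = sup_dist V y x"
  by (simp add: sup_dist_def abs_minus_commute)

lemma abs_diff_le_sup_dist: "finite V \<Longrightarrow> w \<in> V \<Longrightarrow> \<bar>x w - y w\<bar> \<le> sup_dist V x y"
  using sup_dist_le_iff[of V x y "sup_dist V x y"] by simp

lemma sup_dist_triangle:
  assumes "finite V"
  shows "sup_dist V x z \<le> sup_dist V x y + sup_dist V y z"
  unfolding sup_dist_le_iff[OF assms]
proof (intro conjI ballI)
  show "0 \<le> sup_dist V x y + sup_dist V y z"
    by (simp add: assms sup_dist_nonneg)
  fix w assume "w \<in> V"
  then show "\<bar>x w - z w\<bar> \<le> sup_dist V x y + sup_dist V y z"
    using abs_diff_le_sup_dist[OF assms, of w x y] abs_diff_le_sup_dist[OF assms, of w y z]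
    by linarith
qed

text \<open>By contraposition: a pair in \<open>D\<close> at \<open>U\<close>-distance at least
  \<delta> competes in the infimum, so the margin would be at most its \<open>W\<close>-distance,
  hence at most \<open>c\<close>.\<close>

lemma bank_dist_lt_if_separation_margin:
  assumes "s \<in> D" "s' \<in> D" "bank_dist \<phi> W s s' \<le> c" "ereal c < separation_margin \<phi> D W U \<delta>"
  shows "bank_dist \<phi> U s s' < \<delta>"
proof (rule ccontr)
  assume "\<not> bank_dist \<phi> U s s' < \<delta>"
  then have "separation_margin \<phi> D W U \<delta> \<le> ereal (bank_dist \<phi> W s s')"
    unfolding separation_margin_def using assms(1,2) by (intro Inf_lower) (force simp: not_less)
  also have "\<dots> \<le> ereal c"
    using assms(3) by simp
  finally show False
    using assms(4) by simp
qed

text \<open>A modulus need not be monotone, so \<open>\<rho> r\<close> for r < \<delta> need not be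
  comparable with \<open>\<rho> \<delta>\<close>. The comparison is therefore a hypothesis on
  \<rho>: the strict version gives a strict distortion bound, the weak version a weak one.\<close>

theorem theorem6:
  fixes H :: "(real ^ 'd) set"
    and T :: "'w set"
    and \<phi> :: "'w \<Rightarrow> real ^ 'd \<Rightarrow> real"
    and D :: "(real ^ 'd) set set"
    and U W :: "'w set"
    and \<delta> \<tau> \<xi> :: real
    and \<psi> :: "real ^ 'd \<Rightarrow> 'w \<Rightarrow> real"
    and Q :: "real ^ 'd \<Rightarrow> real ^ 'd"
  assumes "\<forall>w\<in>T. \<forall>h\<in>H. \<phi> w h \<in> {0..1}"
    and "D \<subseteq> state_space H T \<phi>"
    and "finite U" and "U \<subseteq> T" and "W \<subseteq> U"
    and "\<delta> > 0" and "\<tau> \<ge> 0" and "\<xi> \<ge> 0"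
    and "\<forall>h\<in>state_preimage H T \<phi> D.
           sup_dist W (\<psi> h) (outcome_vector \<phi> W (state_proj H T \<phi> h)) \<le> \<tau>"
    and "Q ` H \<subseteq> H"
    and "Q ` state_preimage H T \<phi> D \<subseteq> state_preimage H T \<phi> D"
    and "\<forall>h\<in>state_preimage H T \<phi> D. sup_dist W (\<psi> (Q h)) (\<psi> h) \<le> \<xi>"
    and "ereal (\<xi> + 2 * \<tau>) < separation_margin \<phi> D W U \<delta>"
  shows "(\<forall>h\<in>state_preimage H T \<phi> D.
            bank_dist \<phi> U (state_proj H T \<phi> (Q h)) (state_proj H T \<phi> h) < \<delta>) \<and>
         (\<forall>\<rho>. completeness_modulus H T \<phi> U \<rho> \<longrightarrow>
            ((\<forall>r\<in>{0..<\<delta>}. \<rho> r < \<rho> \<delta>) \<longrightarrow>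
               (\<forall>h\<in>state_preimage H T \<phi> D.
                  bank_dist \<phi> T (state_proj H T \<phi> (Q h)) (state_proj H T \<phi> h) < \<rho> \<delta>)) \<and>
            ((\<forall>r\<in>{0..<\<delta>}. \<rho> r \<le> \<rho> \<delta>) \<longrightarrow>
               (\<forall>h\<in>state_preimage H T \<phi> D.
                  bank_dist \<phi> T (state_proj H T \<phi> (Q h)) (state_proj H T \<phi> h) \<le> \<rho> \<delta>)))"
proof -
  have "finite W"
    using \<open>finite U\<close> \<open>W \<subseteq> U\<close> finite_subset by blast
  define P where "P = state_proj H T \<phi>"
  define B where "B = state_preimage H T \<phi> D"
  have PD: "P h \<in> D" if "h \<in> B" for h
    using that by (simp add: B_def P_def state_preimage_def)
  \<comment> \<open>Invariance lets calibration be applied at \<open>Q h\<close> as well, and puts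
    both states into \<open>D\<close>.\<close>
  have QB: "Q h \<in> B" if "h \<in> B" for h
    using that assms(11) by (auto simp: B_def)
  have cal: "sup_dist W (\<psi> h) (outcome_vector \<phi> W (P h)) \<le> \<tau>" if "h \<in> B" for h
    using that assms(9) by (simp add: B_def P_def)
  have dW: "bank_dist \<phi> W (P (Q h)) (P h) \<le> \<xi> + 2 * \<tau>" if "h \<in> B" for h
  proof -
    \<comment> \<open>Two triangle inequalities; symmetry reverses the first leg into the form of
      the calibration bound at \<open>Q h\<close>.\<close>
    have "bank_dist \<phi> W (P (Q h)) (P h)
        \<le> sup_dist W (\<psi> (Q h)) (outcome_vector \<phi> W (P (Q h))) +
          (sup_dist W (\<psi> (Q h)) (\<psi> h) + sup_dist W (\<psi> h) (outcome_vector \<phi> W (P h)))"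
      unfolding bank_dist_def
      using sup_dist_triangle[OF \<open>finite W\<close>] sup_dist_commute
      by (metis add_left_mono order_trans)
    moreover have "sup_dist W (\<psi> (Q h)) (\<psi> h) \<le> \<xi>"
      using that assms(12) by (simp add: B_def)
    ultimately show ?thesis
      using cal[OF that] cal[OF QB[OF that]] by linarith
  qed
  have dU: "bank_dist \<phi> U (P (Q h)) (P h) < \<delta>" if "h \<in> B" for h
    using bank_dist_lt_if_separation_margin[OF PD[OF QB[OF that]] PD[OF that] dW[OF that] assms(13)] .
  \<comment> \<open>The endpoint 0 is included: \<open>Q h\<close> and \<open>h\<close> may agree on
    the whole audit bank.\<close>
  have range: "bank_dist \<phi> U (P (Q h)) (P h) \<in> {0..<\<delta>}" if "h \<in> B" for h
    using dU[OF that] sup_dist_nonneg[OF \<open>finite U\<close>] by (simp add: bank_dist_def)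
  have modulus: "bank_dist \<phi> T (P (Q h)) (P h) \<le> \<rho> (bank_dist \<phi> U (P (Q h)) (P h))"
    if "completeness_modulus H T \<phi> U \<rho>" "h \<in> B" for \<rho> h
    using that PD QB assms(2) unfolding completeness_modulus_def by blast
  show ?thesis
    unfolding P_def[symmetric] B_def[symmetric]
    \<comment> \<open>Instantiate the comparison of \<rho> with \<open>\<rho> \<delta>\<close> at r
      equal to the audit distance.\<close>
    using dU range modulus by (meson order_le_less_trans order_trans)
qed

end
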